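(* Let $n\ge 1$ and let $f:\{-1,1\}^n\to\{-1,1\}$ be an $m$-sparse Boolean function with $m\le 2^{n-1}$. Then $f$ has a polynomial threshold function representation of length at most $2^{n-1}+\min(m,2^{n-2})$.
   Context: A Boolean function $f:\{-1,1\}^n\to\{-1,1\}$ is called $m$-sparse if $m=\min(|f^{-1}(1)|,|f^{-1}(-1)|)$ (the informal requirement that $m$ be small compared with $2^n$ is replaced by the explicit hypothesis on $m$ in the statement). A multilinear real polynomial $p(x)=\sum_{S\subseteq\{1,\dots,n\}} w_S\prod_{k\in S}x_k$ is a polynomial threshold function (PTF) representation of $f$ if $f(x)=\operatorname{sgn}(p(x))$ for all $x\in\{-1,1\}^n$; in particular $p(x)\neq 0$ for all such $x$. Its length is the number of non-zero coefficients $w_S$. *)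

theory Defs
  imports Complex_Main "HOL-Library.FuncSet"
begin

definition cube :: "nat \<Rightarrow> (nat \<Rightarrow> real) set" where
  "cube n = PiE {1..n} (\<lambda>_. {-1, 1})"

text \<open>Boolean functions are identified with their restriction to the cube; values elsewhere
  never matter.\<close>

definition boolean_fun :: "nat \<Rightarrow> ((nat \<Rightarrow> real) \<Rightarrow> real) \<Rightarrow> bool" where
  "boolean_fun n f \<longleftrightarrow> (\<forall>x\<in>cube n. f x \<in> {-1, 1})"

definition sparse_fun :: "nat \<Rightarrow> nat \<Rightarrow> ((nat \<Rightarrow> real) \<Rightarrow> real) \<Rightarrow> bool" where
  "sparse_fun n m f \<longleftrightarrow>
     m = min (card {x \<in> cube n. f x = 1}) (card {x \<in> cube n. f x = -1})"

text \<open>A multilinear polynomial in \<open>x 1, \<dots>, x n\<close> is given by its coefficients, one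
  for each subset of \<open>{1..n}\<close>; coefficients at other sets are ignored.\<close>

definition multilinear_eval :: "nat \<Rightarrow> (nat set \<Rightarrow> real) \<Rightarrow> (nat \<Rightarrow> real) \<Rightarrow> real" where
  "multilinear_eval n w x = (\<Sum>S\<in>Pow {1..n}. w S * (\<Prod>k\<in>S. x k))"

text \<open>Since \<open>sgn 0 = 0\<close>, a representation of a Boolean function cannot vanish on the cube.\<close>

definition ptf_representation ::
  "nat \<Rightarrow> (nat set \<Rightarrow> real) \<Rightarrow> ((nat \<Rightarrow> real) \<Rightarrow> real) \<Rightarrow> bool" where
  "ptf_representation n w f \<longleftrightarrow> (\<forall>x\<in>cube n. f x = sgn (multilinear_eval n w x))"

definition ptf_length :: "nat \<Rightarrow> (nat set \<Rightarrow> real) \<Rightarrow> nat" where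
  "ptf_length n w = card {S \<in> Pow {1..n}. w S \<noteq> 0}"

end

theory Submission
  imports Defs
begin

text \<open>Write \<open>p = q + x\<^sub>n r\<close> with \<open>q, r\<close> in the first \<open>n - 1\<close> variables. On the set \<open>A\<close> of points
  \<open>y\<close> of the smaller cube with \<open>f (y, 1) = f (y, -1)\<close> the sign condition on \<open>p\<close> asks that \<open>q\<close> dominate
  and have the sign of \<open>f\<close>; on the complement \<open>B\<close> the same is asked of \<open>r\<close>. Interpolating one of them on
  its own part only costs as many monomials as that part has points; the other one is then
  interpolated on the whole smaller cube, zero on the first part and very large on its own. This gives
  length at most \<open>2 ^ (n - 1) + min (card A) (card B)\<close>. The two cardinalities add up to
  \<open>2 ^ (n - 1)\<close>, and every \<open>y \<in> B\<close> lies below exactly one point of \<open>f\<^sup>-\<^sup>1(1)\<close> and one of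
  \<open>f\<^sup>-\<^sup>1(-1)\<close>, so \<open>card B \<le> m\<close>.\<close>

section \<open>Splitting the cube along its last coordinate\<close>

lemma finite_cube [simp]: "finite (cube n)"
  by (simp add: cube_def finite_PiE)

lemma card_cube: "card (cube n) = 2 ^ n"
  by (simp add: cube_def card_PiE flip: numeral_2_eq_2)

lemma ptf_length_le: "ptf_length n w \<le> 2 ^ n"
proof -
  have "ptf_length n w \<le> card (Pow {1..n})"
    unfolding ptf_length_def by (intro card_mono) auto
  then show ?thesis by (simp add: card_Pow)
qed

lemma atLeast1_atMost_Suc: "{1..Suc n} = insert (Suc n) {1..n}"
  by auto

lemma cube_Suc: "cube (Suc n) = (\<lambda>(s, y). y(Suc n := s)) ` ({-1, 1} \<times> cube n)"
  unfolding cube_def atLeast1_atMost_Suc by (rule PiE_insert_eq)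

lemma cube_SucI: "y \<in> cube n \<Longrightarrow> s = -1 \<or> s = 1 \<Longrightarrow> y(Suc n := s) \<in> cube (Suc n)"
  unfolding cube_Suc by (rule image_eqI[of _ _ "(s, y)"]) auto

lemma cube_SucE:
  assumes "x \<in> cube (Suc n)"
  obtains y s where "y \<in> cube n" "s = -1 \<or> s = 1" "x = y(Suc n := s)"
proof -
  obtain p where p: "p \<in> {-1, 1} \<times> cube n" "x = (\<lambda>(s, y). y(Suc n := s)) p"
    using assms unfolding cube_Suc by (rule imageE) (rule that)
  show thesis
    by (rule that[of "snd p" "fst p"]) (use p in \<open>auto simp: case_prod_beta\<close>)
qed

text \<open>Points of \<open>cube n\<close> are \<open>undefined\<close> at \<open>Suc n\<close>, so
  overwriting that coordinate loses no information.\<close>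

lemma cube_upd_eq_iff:
  assumes "y \<in> cube n" "z \<in> cube n"
  shows "y(Suc n := s) = z(Suc n := t) \<longleftrightarrow> y = z \<and> s = t"
proof
  assume eq: "y(Suc n := s) = z(Suc n := t)"
  have "y k = z k" for k
  proof (cases "k = Suc n")
    case True
    then show ?thesis using assms[unfolded cube_def, THEN PiE_arb, of k] by simp
  next
    case False
    then show ?thesis using fun_cong[OF eq, of k] by simp
  qed
  then show "y = z \<and> s = t" using fun_cong[OF eq, of "Suc n"] by auto
qed simp

section \<open>Splitting a multilinear polynomial along its last variable\<close>

lemma multilinear_eval_upd [simp]: "multilinear_eval n w (y(Suc n := s)) = multilinear_eval n w y"
  unfolding multilinear_eval_def
proof (intro sum.cong refl)
  fix S assume "S \<in> Pow {1..n}"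
  then have "(\<Prod>k\<in>S. (y(Suc n := s)) k) = (\<Prod>k\<in>S. y k)"
    by (intro prod.cong) auto
  then show "w S * (\<Prod>k\<in>S. (y(Suc n := s)) k) = w S * (\<Prod>k\<in>S. y k)" by simp
qed

text \<open>The coefficients of \<open>q + x k * r\<close> when neither \<open>q\<close> nor
  \<open>r\<close> involves \<open>x k\<close>. The monomials of the two summands are distinct, so
  nothing cancels and the lengths add up.\<close>

definition join_coeffs :: "nat \<Rightarrow> (nat set \<Rightarrow> real) \<Rightarrow> (nat set \<Rightarrow> real) \<Rightarrow> nat set \<Rightarrow> real" where
  "join_coeffs k q r S = (if k \<in> S then r (S - {k}) else q S)"

lemma Pow_Suc: "Pow {1..Suc n} = Pow {1..n} \<union> insert (Suc n) ` Pow {1..n}"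
  unfolding atLeast1_atMost_Suc by (rule Pow_insert)

lemma inj_on_insert_Suc: "inj_on (insert (Suc n)) (Pow {1..n})"
  proof (rule inj_onI)
  fix S T assume "S \<in> Pow {1..n}" "T \<in> Pow {1..n}" "insert (Suc n) S = insert (Suc n) T"
  moreover from this have "Suc n \<notin> S" "Suc n \<notin> T" by auto
  ultimately show "S = T" by (simp add: insert_ident)
qed

lemma Suc_notin [simp]: "S \<subseteq> {1..n} \<Longrightarrow> Suc n \<notin> S"
  by auto

lemma multilinear_eval_join:
  "multilinear_eval (Suc n) (join_coeffs (Suc n) q r) x
     = multilinear_eval n q x + x (Suc n) * multilinear_eval n r x"
proof -
  let ?w = "join_coeffs (Suc n) q r"
  have "multilinear_eval (Suc n) ?w x = (\<Sum>S\<in>Pow {1..n}. ?w S * (\<Prod>k\<in>S. x k))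
      + (\<Sum>S\<in>insert (Suc n) ` Pow {1..n}. ?w S * (\<Prod>k\<in>S. x k))"
    unfolding multilinear_eval_def Pow_Suc by (intro sum.union_disjoint) auto
  also have "(\<Sum>S\<in>Pow {1..n}. ?w S * (\<Prod>k\<in>S. x k)) = multilinear_eval n q x"
    unfolding multilinear_eval_def by (intro sum.cong) (auto simp: join_coeffs_def)
  also have "(\<Sum>S\<in>insert (Suc n) ` Pow {1..n}. ?w S * (\<Prod>k\<in>S. x k))
      = x (Suc n) * multilinear_eval n r x"
    unfolding multilinear_eval_def sum.reindex[OF inj_on_insert_Suc] sum_distrib_left
  proof (intro sum.cong refl)
    fix S assume "S \<in> Pow {1..n}"
    then have "Suc n \<notin> S" "finite S" by (auto intro: finite_subset)
    then show "((\<lambda>S. ?w S * (\<Prod>k\<in>S. x k)) \<circ> insert (Suc n)) S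
        = x (Suc n) * (r S * (\<Prod>k\<in>S. x k))"
      by (simp add: join_coeffs_def)
  qed
  finally show ?thesis .
qed

lemma ptf_length_join:
  "ptf_length (Suc n) (join_coeffs (Suc n) q r) = ptf_length n q + ptf_length n r"
proof -
  have "{S \<in> Pow {1..Suc n}. join_coeffs (Suc n) q r S \<noteq> 0}
      = {S \<in> Pow {1..n}. q S \<noteq> 0} \<union> insert (Suc n) ` {S \<in> Pow {1..n}. r S \<noteq> 0}"
    unfolding Pow_Suc join_coeffs_def by auto
  moreover have "card (insert (Suc n) ` {S \<in> Pow {1..n}. r S \<noteq> 0}) = ptf_length n r"
    unfolding ptf_length_def
    by (intro card_image inj_on_subset[OF inj_on_insert_Suc]) auto
  moreover have "card ({S \<in> Pow {1..n}. q S \<noteq> 0} \<union> insert (Suc n) ` {S \<in> Pow {1..n}. r S \<noteq> 0})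
      = card {S \<in> Pow {1..n}. q S \<noteq> 0} + card (insert (Suc n) ` {S \<in> Pow {1..n}. r S \<noteq> 0})"
    by (intro card_Un_disjoint) auto
  ultimately show ?thesis unfolding ptf_length_def by simp
qed

section \<open>Interpolation, on the whole cube and on a subset\<close>

lemma multilinear_interpolation: "\<exists>w. \<forall>x\<in>cube n. multilinear_eval n w x = g x"
proof (induction n arbitrary: g)
  case 0
  then show ?case
    \<comment> \<open>The only point of \<open>cube 0\<close> is
      \<open>\<lambda>_. undefined\<close>, and the only monomial is the constant one.\<close>
    by (intro exI[of _ "\<lambda>_. g (\<lambda>_. undefined)"]) (simp add: cube_def multilinear_eval_def)
next
  case (Suc n)
  \<comment> \<open>\<open>q\<close> and \<open>r\<close> interpolate the even and the odd part of
    \<open>g\<close> in the last variable.\<close>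
  obtain q where q: "\<forall>y\<in>cube n. multilinear_eval n q y = (g (y(Suc n := 1)) + g (y(Suc n := -1))) / 2"
    using Suc.IH[of "\<lambda>y. (g (y(Suc n := 1)) + g (y(Suc n := -1))) / 2"] by blast
  obtain r where r: "\<forall>y\<in>cube n. multilinear_eval n r y = (g (y(Suc n := 1)) - g (y(Suc n := -1))) / 2"
    using Suc.IH[of "\<lambda>y. (g (y(Suc n := 1)) - g (y(Suc n := -1))) / 2"] by blast
  have "multilinear_eval (Suc n) (join_coeffs (Suc n) q r) x = g x" if "x \<in> cube (Suc n)" for x
  proof -
    obtain y s where y: "y \<in> cube n" and s: "s = -1 \<or> s = 1" and x: "x = y(Suc n := s)"
      using \<open>x \<in> cube (Suc n)\<close> by (rule cube_SucE)
    have "multilinear_eval (Suc n) (join_coeffs (Suc n) q r) x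
        = (g (y(Suc n := 1)) + g (y(Suc n := -1))) / 2
          + s * ((g (y(Suc n := 1)) - g (y(Suc n := -1))) / 2)"
      unfolding x multilinear_eval_join multilinear_eval_upd fun_upd_same
        bspec[OF q y] bspec[OF r y] ..
    then show ?thesis using s unfolding x by (elim disjE) (simp_all add: field_simps)
  qed
  then show ?case by blast
qed

text \<open>Gaussian elimination: a point \<open>a\<close> is removed by subtracting multiples of a function
  \<open>\<phi> j\<close> that does not vanish there, at the cost of the single index \<open>j\<close>.\<close>

lemma sparse_linear_combination:
  fixes \<phi> :: "'i \<Rightarrow> 'a \<Rightarrow> 'k::field"
  assumes "finite A" "finite I" "\<forall>x\<in>A. g x = (\<Sum>i\<in>I. w i * \<phi> i x)"
  shows "\<exists>v. card {i \<in> I. v i \<noteq> 0} \<le> card A \<and> (\<forall>x\<in>A. g x = (\<Sum>i\<in>I. v i * \<phi> i x))"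
  using assms
proof (induction A arbitrary: I \<phi> g w rule: finite_induct)
  case empty
  show ?case by (rule exI[of _ "\<lambda>_. 0"]) simp
next
  case (insert a A)
  show ?case
  proof (cases "\<forall>i\<in>I. \<phi> i a = 0")
    case True
    obtain v where v: "card {i \<in> I. v i \<noteq> 0} \<le> card A" "\<forall>x\<in>A. g x = (\<Sum>i\<in>I. v i * \<phi> i x)"
      using insert.IH[of I g w \<phi>] insert.prems by auto
    \<comment> \<open>The given representation forces \<open>g a = 0\<close>, and every combination
      vanishes at \<open>a\<close>, so coefficients found for \<open>A\<close> serve for
      \<open>a\<close> too.\<close>
    have "g a = (\<Sum>i\<in>I. v i * \<phi> i a)" using insert.prems True by simp
    then show ?thesis using v insert.hyps by (intro exI[of _ v]) auto
  next
    case False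
    then obtain j where j: "j \<in> I" "\<phi> j a \<noteq> 0" by blast
    define J where "J = I - {j}"
    have J: "finite J" "j \<notin> J" "I = insert j J" using insert.prems j by (auto simp: J_def)
    define \<psi> where "\<psi> i x = \<phi> i x - \<phi> i a / \<phi> j a * \<phi> j x" for i x
    define h where "h x = g x - g a / \<phi> j a * \<phi> j x" for x
    have expand: "(\<Sum>i\<in>J. u i * \<psi> i x)
        = (\<Sum>i\<in>J. u i * \<phi> i x) - (\<Sum>i\<in>J. u i * \<phi> i a) / \<phi> j a * \<phi> j x" for u x
      by (simp add: \<psi>_def algebra_simps sum_subtractf sum_distrib_left sum_divide_distrib)
    \<comment> \<open>In \<open>h\<close> the term \<open>w j * \<phi> j x\<close> cancels, once
      \<open>g a\<close> is replaced by its expansion at \<open>a\<close>.\<close>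
    have "h x = (\<Sum>i\<in>J. w i * \<psi> i x)" if "x \<in> A" for x
    proof -
      have "g x = w j * \<phi> j x + (\<Sum>i\<in>J. w i * \<phi> i x)" "g a = w j * \<phi> j a + (\<Sum>i\<in>J. w i * \<phi> i a)"
        using insert.prems that J by simp_all
      then show ?thesis using j by (simp add: expand h_def field_simps)
    qed
    then obtain v where v: "card {i \<in> J. v i \<noteq> 0} \<le> card A"
        "\<And>x. x \<in> A \<Longrightarrow> h x = (\<Sum>i\<in>J. v i * \<psi> i x)"
      using insert.IH[of J h w \<psi>] J by blast
    \<comment> \<open>The coefficient at \<open>j\<close> is solved from the equation at
      \<open>a\<close>; on \<open>A\<close> it undoes the subtractions in \<open>\<psi>\<close> and
      \<open>h\<close>.\<close>
    define u where "u = v(j := (g a - (\<Sum>i\<in>J. v i * \<phi> i a)) / \<phi> j a)"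
    have u_J: "(\<Sum>i\<in>J. u i * \<phi> i x) = (\<Sum>i\<in>J. v i * \<phi> i x)" for x
      using J by (intro sum.cong) (auto simp: u_def)
    have u_I: "(\<Sum>i\<in>I. u i * \<phi> i x)
        = (g a - (\<Sum>i\<in>J. v i * \<phi> i a)) / \<phi> j a * \<phi> j x + (\<Sum>i\<in>J. v i * \<phi> i x)" for x
      using J by (simp add: u_J) (simp add: u_def)
    have "g x = (\<Sum>i\<in>I. u i * \<phi> i x)" if "x \<in> insert a A" for x
    proof (cases "x = a")
      case True
      then show ?thesis using j by (simp add: u_I)
    next
      case False
      then have "h x = (\<Sum>i\<in>J. v i * \<psi> i x)" using that v(2) by blast
      then show ?thesis using j by (simp add: u_I expand h_def field_simps)
    qed
    moreover have "card {i \<in> I. u i \<noteq> 0} \<le> card (insert a A)"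
    proof -
      have "{i \<in> I. u i \<noteq> 0} \<subseteq> insert j {i \<in> J. v i \<noteq> 0}" using J by (auto simp: u_def)
      then have "card {i \<in> I. u i \<noteq> 0} \<le> card (insert j {i \<in> J. v i \<noteq> 0})"
        using J by (intro card_mono) auto
      also have "\<dots> \<le> Suc (card {i \<in> J. v i \<noteq> 0})" using J by (simp add: card_insert_if)
      finally show ?thesis using v(1) insert.hyps by simp
    qed
    ultimately show ?thesis by blast
  qed
qed

text \<open>Interpolation on the whole cube supplies some representation of \<open>g\<close> on
  \<open>A\<close>; elimination among the monomials then shortens it.\<close>

lemma sparse_multilinear_interpolation:
  assumes "A \<subseteq> cube n"
  shows "\<exists>w. ptf_length n w \<le> card A \<and> (\<forall>x\<in>A. multilinear_eval n w x = g x)"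
proof -
  obtain w where "\<forall>x\<in>cube n. multilinear_eval n w x = g x"
    using multilinear_interpolation by blast
  then have "\<forall>x\<in>A. g x = (\<Sum>S\<in>Pow {1..n}. w S * (\<Prod>k\<in>S. x k))"
    using assms by (auto simp: multilinear_eval_def)
  then obtain v where "card {S \<in> Pow {1..n}. v S \<noteq> 0} \<le> card A"
      "\<forall>x\<in>A. g x = (\<Sum>S\<in>Pow {1..n}. v S * (\<Prod>k\<in>S. x k))"
    using sparse_linear_combination[of A "Pow {1..n}" g w "\<lambda>S x. \<Prod>k\<in>S. x k"]
      finite_subset[OF assms] by auto
  then show ?thesis by (auto simp: ptf_length_def multilinear_eval_def)
qed

section \<open>Sign representation by a dominating pair of polynomials\<close>

lemma dominating_pair:
  assumes "A \<subseteq> cube n" and h: "\<And>y. y \<in> cube n \<Longrightarrow> h y \<in> {-1, 1 :: real}"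
  obtains u v where "ptf_length n u + ptf_length n v \<le> 2 ^ n + card A"
    and "\<And>y. y \<in> A \<Longrightarrow>
      sgn (multilinear_eval n u y) = h y \<and> \<bar>multilinear_eval n v y\<bar> < \<bar>multilinear_eval n u y\<bar>"
    and "\<And>y. y \<in> cube n - A \<Longrightarrow>
      sgn (multilinear_eval n v y) = h y \<and> \<bar>multilinear_eval n u y\<bar> < \<bar>multilinear_eval n v y\<bar>"
proof -
  obtain u where u: "ptf_length n u \<le> card A" "\<forall>y\<in>A. multilinear_eval n u y = h y"
    using sparse_multilinear_interpolation[OF assms(1)] by blast
  \<comment> \<open>The sum bounds every single value of \<open>u\<close> on the cube; the summand 1
    makes the bound strict and \<open>M\<close> positive.\<close>
  define M where "M = 1 + (\<Sum>y\<in>cube n. \<bar>multilinear_eval n u y\<bar>)"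
  have M: "\<bar>multilinear_eval n u y\<bar> < M" if "y \<in> cube n" for y
    using member_le_sum[OF that, of "\<lambda>y. \<bar>multilinear_eval n u y\<bar>"] by (simp add: M_def)
  have "M > 0" by (simp add: M_def add_pos_nonneg sum_nonneg)
  obtain v where v: "\<forall>y\<in>cube n. multilinear_eval n v y = (if y \<in> A then 0 else M * h y)"
    using multilinear_interpolation[of n "\<lambda>y. if y \<in> A then 0 else M * h y"] by blast
  show thesis
  proof (rule that)
    show "ptf_length n u + ptf_length n v \<le> 2 ^ n + card A"
      using u(1) ptf_length_le[of n v] by simp
  next
    fix y assume y: "y \<in> A"
    then have "y \<in> cube n" using assms(1) by blast
    with y show "sgn (multilinear_eval n u y) = h y \<and>
        \<bar>multilinear_eval n v y\<bar> < \<bar>multilinear_eval n u y\<bar>"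
      using u(2) v h[of y] by auto
  next
    fix y assume y: "y \<in> cube n - A"
    then show "sgn (multilinear_eval n v y) = h y \<and>
        \<bar>multilinear_eval n u y\<bar> < \<bar>multilinear_eval n v y\<bar>"
      using v h[of y] M[of y] \<open>M > 0\<close> by (auto simp: sgn_mult)
  qed
qed

lemma sgn_add_dominated:
  fixes a b :: real
  assumes "\<bar>b\<bar> < \<bar>a\<bar>"
  shows "sgn (a + b) = sgn a"
  using assms by (auto simp: sgn_if abs_if split: if_splits)

text \<open>At \<open>s = 1\<close> and \<open>s = -1\<close> the joined polynomial is
  \<open>q + r\<close> and \<open>q - r\<close>. The sign is the same at both if \<open>q\<close>
  dominates and opposite if \<open>r\<close> does.\<close>

lemma ptf_representation_join:
  assumes f: "boolean_fun (Suc n) f"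
    and agree: "\<And>y. y \<in> cube n \<Longrightarrow> f (y(Suc n := 1)) = f (y(Suc n := -1)) \<Longrightarrow>
      sgn (multilinear_eval n q y) = f (y(Suc n := 1)) \<and>
      \<bar>multilinear_eval n r y\<bar> < \<bar>multilinear_eval n q y\<bar>"
    and differ: "\<And>y. y \<in> cube n \<Longrightarrow> f (y(Suc n := 1)) \<noteq> f (y(Suc n := -1)) \<Longrightarrow>
      sgn (multilinear_eval n r y) = f (y(Suc n := 1)) \<and>
      \<bar>multilinear_eval n q y\<bar> < \<bar>multilinear_eval n r y\<bar>"
  shows "ptf_representation (Suc n) (join_coeffs (Suc n) q r) f"
  unfolding ptf_representation_def
proof
  fix x assume "x \<in> cube (Suc n)"
  then obtain y s where y: "y \<in> cube n" and s: "s = -1 \<or> s = 1" and x: "x = y(Suc n := s)"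
    by (rule cube_SucE)
  have vals: "f (y(Suc n := t)) \<in> {-1, 1}" if "t = -1 \<or> t = 1" for t
    using f cube_SucI[OF y that] unfolding boolean_fun_def by blast
  have "f (y(Suc n := s)) = sgn (multilinear_eval n q y + s * multilinear_eval n r y)"
  proof (cases "f (y(Suc n := 1)) = f (y(Suc n := -1))")
    case True
    then have "f (y(Suc n := s)) = sgn (multilinear_eval n q y)"
      using agree[OF y] s by auto
    also have "\<dots> = sgn (multilinear_eval n q y + s * multilinear_eval n r y)"
      using agree[OF y True] s by (intro sgn_add_dominated[symmetric]) auto
    finally show ?thesis .
  next
    case False
    \<comment> \<open>Two different values in \<open>{-1, 1}\<close> are negatives of each
      other.\<close>
    then have "f (y(Suc n := s)) = s * sgn (multilinear_eval n r y)"
      using differ[OF y] s vals[of 1] vals[of "-1"] by auto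
    also have "\<dots> = sgn (s * multilinear_eval n r y)"
      using s by (auto simp: sgn_mult)
    also have "\<dots> = sgn (s * multilinear_eval n r y + multilinear_eval n q y)"
      using differ[OF y False] s by (intro sgn_add_dominated[symmetric]) auto
    also have "\<dots> = sgn (multilinear_eval n q y + s * multilinear_eval n r y)"
      by (simp add: add.commute)
    finally show ?thesis .
  qed
  then show "f x = sgn (multilinear_eval (Suc n) (join_coeffs (Suc n) q r) x)"
    by (simp add: multilinear_eval_join x)
qed

text \<open>Of the two points above such a \<open>y\<close> exactly one has value \<open>c\<close>,
  and it determines \<open>y\<close>. Both values of \<open>c\<close> are covered because
  \<open>m\<close> is the minimum over the two fibres.\<close>

lemma card_differ_le:
  assumes f: "boolean_fun (Suc n) f" and c: "c \<in> {-1, 1}"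
  shows "card {y \<in> cube n. f (y(Suc n := 1)) \<noteq> f (y(Suc n := -1))} \<le> card {x \<in> cube (Suc n). f x = c}"
proof (rule card_inj_on_le)
  let ?i = "\<lambda>y. if f (y(Suc n := 1)) = c then y(Suc n := 1) else y(Suc n := -1)"
  let ?B = "{y \<in> cube n. f (y(Suc n := 1)) \<noteq> f (y(Suc n := -1))}"
  show "inj_on ?i ?B"
    by (intro inj_onI) (auto simp: cube_upd_eq_iff split: if_splits)
  have vals: "y(Suc n := t) \<in> cube (Suc n) \<and> f (y(Suc n := t)) \<in> {-1, 1}"
    if "y \<in> cube n" "t = -1 \<or> t = 1" for y t
    using f cube_SucI[OF that] unfolding boolean_fun_def by blast
  show "?i ` ?B \<subseteq> {x \<in> cube (Suc n). f x = c}"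
  proof (intro image_subsetI)
    fix y assume "y \<in> ?B"
    then show "?i y \<in> {x \<in> cube (Suc n). f x = c}"
      using vals[of y 1] vals[of y "-1"] c by auto
  qed
qed simp

theorem theorem5:
  fixes n m :: nat and f :: "(nat \<Rightarrow> real) \<Rightarrow> real"
  assumes "n \<ge> 1"
    and "boolean_fun n f"
    and "sparse_fun n m f"
    and "m \<le> 2 ^ (n - 1)"
  shows "\<exists>w :: nat set \<Rightarrow> real. ptf_representation n w f \<and>
           real (ptf_length n w) \<le> 2 ^ (n - 1) + min (real m) (2 powi (int n - 2))"
proof -
  obtain k where n: "n = Suc k" using assms(1) by (cases n) auto
  note f = assms(2)[unfolded n]
  let ?h = "\<lambda>y. f (y(Suc k := 1))"
  define A where "A = {y \<in> cube k. ?h y = f (y(Suc k := -1))}"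
  define B where "B = {y \<in> cube k. ?h y \<noteq> f (y(Suc k := -1))}"
  have h: "?h y \<in> {-1, 1}" if "y \<in> cube k" for y
    using f cube_SucI[OF that, of 1] unfolding boolean_fun_def by blast
  have "card A + card B = card (A \<union> B)"
    by (intro card_Un_disjoint[symmetric]) (auto simp: A_def B_def)
  also have "A \<union> B = cube k" by (auto simp: A_def B_def)
  finally have card_AB: "card A + card B = 2 ^ k" by (simp add: card_cube)
  have "card B \<le> m"
    using assms(3) card_differ_le[OF f] by (simp add: sparse_fun_def n B_def)
  \<comment> \<open>Here \<open>q\<close> is the sparse interpolant on \<open>A\<close>, and
    \<open>r\<close> vanishes on \<open>A\<close>.\<close>
  have "\<exists>w. ptf_representation n w f \<and> ptf_length n w \<le> 2 ^ k + card A"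
  proof -
    have "A \<subseteq> cube k" by (auto simp: A_def)
    then obtain q r where "ptf_length k q + ptf_length k r \<le> 2 ^ k + card A"
      and "\<And>y. y \<in> A \<Longrightarrow> sgn (multilinear_eval k q y) = ?h y \<and>
        \<bar>multilinear_eval k r y\<bar> < \<bar>multilinear_eval k q y\<bar>"
      and "\<And>y. y \<in> cube k - A \<Longrightarrow> sgn (multilinear_eval k r y) = ?h y \<and>
        \<bar>multilinear_eval k q y\<bar> < \<bar>multilinear_eval k r y\<bar>"
      using dominating_pair[of A k ?h] h by metis
    then show ?thesis unfolding n
      by (intro exI[of _ "join_coeffs (Suc k) q r"] conjI ptf_representation_join f)
        (auto simp: A_def ptf_length_join)
  qed
  \<comment> \<open>The roles are exchanged: \<open>r\<close> is the sparse interpolant, on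
    \<open>B\<close>, and \<open>q\<close> vanishes there.\<close>
  moreover have "\<exists>w. ptf_representation n w f \<and> ptf_length n w \<le> 2 ^ k + card B"
  proof -
    have "B \<subseteq> cube k" by (auto simp: B_def)
    then obtain r q where "ptf_length k r + ptf_length k q \<le> 2 ^ k + card B"
      and "\<And>y. y \<in> B \<Longrightarrow> sgn (multilinear_eval k r y) = ?h y \<and>
        \<bar>multilinear_eval k q y\<bar> < \<bar>multilinear_eval k r y\<bar>"
      and "\<And>y. y \<in> cube k - B \<Longrightarrow> sgn (multilinear_eval k q y) = ?h y \<and>
        \<bar>multilinear_eval k r y\<bar> < \<bar>multilinear_eval k q y\<bar>"
      using dominating_pair[of B k ?h] h by metis
    then show ?thesis unfolding n
      by (intro exI[of _ "join_coeffs (Suc k) q r"] conjI ptf_representation_join f)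
        (auto simp: B_def ptf_length_join)
  qed
  ultimately obtain w where w: "ptf_representation n w f"
      "ptf_length n w \<le> 2 ^ k + min (card A) (card B)"
    by (cases "card A \<le> card B") (auto simp: min_def)
  \<comment> \<open>The exponent is an integer: for \<open>n = 1\<close> the value is
    \<open>1/2\<close>.\<close>
  have "(2::real) powi (int n - 2) = 2 ^ k / 2"
  proof -
    have "int n - 2 = int k - 1" by (simp add: n)
    then show ?thesis by (simp add: power_int_diff)
  qed
  \<comment> \<open>The smaller of two numbers is at most half their sum.\<close>
  moreover have "real (min (card A) (card B)) \<le> 2 ^ k / 2"
  proof -
    have "real (card A) + real (card B) = 2 ^ k"
      using arg_cong[OF card_AB, of real] by simp
    then show ?thesis by (simp add: min_def)
  qed
  moreover have "real (min (card A) (card B)) \<le> real m" using \<open>card B \<le> m\<close> by simp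
  moreover have "real (ptf_length n w) \<le> 2 ^ k + real (min (card A) (card B))"
    using of_nat_mono[OF w(2), where 'a = real] by simp
  ultimately show ?thesis using w(1) by (intro exI[of _ w]) (simp add: n)
qed

end
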